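(* Let $X_1,X_2$ be real random variables whose risk measures (as defined in the context) are finite, let $g(u)=F_{X_1}^{-1}(u)+F_{X_2}^{-1}(1-u)$, and let $S^l=g(U)$ with $U$ uniformly distributed on the unit interval, where $S^l$ is not degenerate. For any $p\in(0,1)$ and $\alpha\in[0,1]$, put $x=F_{S^l}^{-1(\alpha)}(p)$ and let $u_1<\dots<u_N$ be the $N$ ordered elements of the set $E_x$. Then $$\mathrm{TVaR}_p[S^l]=\begin{cases}\frac{1}{1-p}\,t_1^\alpha(p), & \text{if } g(u)\le x \text{ for } u\in(0,u_1),\\[1mm] \frac{1}{1-p}\,t_2^\alpha(p), & \text{if } g(u)\ge x \text{ for } u\in(0,u_1),\end{cases}$$ where $$t_1^\alpha(p)=(1-u_1)\left(\mathrm{TVaR}_{u_1}[X_1]+\mathrm{LTVaR}_{1-u_1}[X_2]\right)-\mathcal{T}+x\left(u_1+\mathcal{D}-p\right),$$ $$t_2^\alpha(p)=u_1\left(\mathrm{LTVaR}_{u_1}[X_1]+\mathrm{TVaR}_{1-u_1}[X_2]\right)+\mathcal{T}+x\left(1-u_1-\mathcal{D}-p\right),$$ $$\mathcal{T}=\sum_{j=2}^{N}(-1)^j(1-u_j)\left(\mathrm{TVaR}_{u_j}[X_1]+\mathrm{LTVaR}_{1-u_j}[X_2]\right),\qquad \mathcal{D}=\sum_{j=2}^{N}(-1)^j(1-u_j),$$ with the convention $\sum_{j=2}^{1}=0$.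
   Context: Random variables may be discrete, continuous, or a combination of the two. For a real random variable $X$ with cdf $F_X$: $F_X^{-1}(p)=\inf\{y\in\mathbb{R}: F_X(y)\ge p\}$, $F_X^{-1+}(p)=\sup\{y\in\mathbb{R}: F_X(y)\le p\}$, with $\inf\emptyset=+\infty$, $\sup\emptyset=-\infty$, and for $\alpha\in[0,1]$, $F_X^{-1(\alpha)}(p)=(1-\alpha)F_X^{-1}(p)+\alpha F_X^{-1+}(p)$. $\mathrm{TVaR}_p[X]=\frac{1}{1-p}\int_p^1F_X^{-1}(q)\,dq$ and $\mathrm{LTVaR}_p[X]=\frac1p\int_0^pF_X^{-1}(q)\,dq$. $x^{\min}=\inf_{u\in[0,1]}g(u)$ and $x^{\max}=\sup_{u\in[0,1]}g(u)$. Set $E_x$ (associated with $g$), for $x\in(x^{\min},x^{\max})$: a point $u^*\in(0,1)$ belongs to $E_x$ if and only if there exist $a,b,c\in[0,1]$ with $a<b\le u^*<c$ such that one of the following holds: (1) $g(u)<x$ for $u\in(a,b)$, $g(u)=x$ for $u\in(b,u^* )$, and $g(u)>x$ for $u\in(u^*,c)$; (2) $g(u)>x$ for $u\in(a,b)$, $g(u)=x$ for $u\in(b,u^* )$, and $g(u)<x$ for $u\in(u^*,c)$. (If $b=u^*$ the middle requirement is vacuous.) $N$ denotes the number of elements of $E_x$; $E_x$ is at most countably infinite, and $N=\infty$ is allowed.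
   Formalization: Assumes additionally that between any interval where g<x and any where g>x (either order) there is a point of E_x, without which the formula can fail, that E_x is nonempty, and, if N is infinite, that the series D converges (otherwise the formula is undefined). *)

theory Defs
  imports "HOL-Probability.Probability" "HOL-Library.Extended_Nat"
begin

section \<open>Quantiles and tail risk measures\<close>

text \<open>
  The extended-real conventions for the infimum and supremum of the empty set only matter at
  \<open>p = 0\<close> and \<open>p = 1\<close>. For \<open>0 < p < 1\<close> both sets below are nonempty and bounded on the relevant
  side, so the real-valued \<^const>\<open>Inf\<close> and \<^const>\<open>Sup\<close> give the usual quantiles. Nothing below
  depends on the (arbitrary) values outside \<open>0 < p < 1\<close>.
\<close>

definition left_quantile :: "'a measure \<Rightarrow> ('a \<Rightarrow> real) \<Rightarrow> real \<Rightarrow> real" where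
  "left_quantile M X p = Inf {y. cdf (distr M borel X) y \<ge> p}"

definition right_quantile :: "'a measure \<Rightarrow> ('a \<Rightarrow> real) \<Rightarrow> real \<Rightarrow> real" where
  "right_quantile M X p = Sup {y. cdf (distr M borel X) y \<le> p}"

definition alpha_quantile :: "'a measure \<Rightarrow> ('a \<Rightarrow> real) \<Rightarrow> real \<Rightarrow> real \<Rightarrow> real" where
  "alpha_quantile M X \<alpha> p = (1 - \<alpha>) * left_quantile M X p + \<alpha> * right_quantile M X p"

definition TVaR :: "'a measure \<Rightarrow> ('a \<Rightarrow> real) \<Rightarrow> real \<Rightarrow> real" where
  "TVaR M X p = 1 / (1 - p) * (LINT q:{p<..<1}|lborel. left_quantile M X q)"

definition LTVaR :: "'a measure \<Rightarrow> ('a \<Rightarrow> real) \<Rightarrow> real \<Rightarrow> real" where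
  "LTVaR M X p = 1 / p * (LINT q:{0<..<p}|lborel. left_quantile M X q)"

text \<open>
  On \<open>(p, 1)\<close> the quantile function is bounded below and on \<open>(0, p)\<close> it is bounded above, so these
  integrals always exist in the extended reals; they are finite iff the integrand is integrable.
  The quantiles themselves are always finite for \<open>0 < p < 1\<close>.
\<close>

definition finite_risk_measures :: "'a measure \<Rightarrow> ('a \<Rightarrow> real) \<Rightarrow> bool" where
  "finite_risk_measures M X \<longleftrightarrow>
     (\<forall>p. 0 < p \<and> p < 1 \<longrightarrow>
        set_integrable lborel {p<..<1} (left_quantile M X) \<and>
        set_integrable lborel {0<..<p} (left_quantile M X))"


section \<open>The counter-monotonic sum and its crossing points\<close>

definition counter_sum :: "'a measure \<Rightarrow> ('a \<Rightarrow> real) \<Rightarrow> ('a \<Rightarrow> real) \<Rightarrow> real \<Rightarrow> real" where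
  "counter_sum M X\<^sub>1 X\<^sub>2 u = left_quantile M X\<^sub>1 u + left_quantile M X\<^sub>2 (1 - u)"

text \<open>
  The set \<open>E\<^sub>x\<close>. It only involves values of \<open>g\<close> on \<open>(0, 1)\<close>, and it is empty unless \<open>g\<close> takes both
  values below and values above \<open>x\<close> there, so no separate restriction of \<open>x\<close> to the interval
  between the infimum and the supremum of \<open>g\<close> is needed.
\<close>

definition crossing_set :: "(real \<Rightarrow> real) \<Rightarrow> real \<Rightarrow> real set" where
  "crossing_set g x = {v. 0 < v \<and> v < 1 \<and>
     (\<exists>a\<in>{0..1}. \<exists>b\<in>{0..1}. \<exists>c\<in>{0..1}. a < b \<and> b \<le> v \<and> v < c \<and>
       ((\<forall>u\<in>{a<..<b}. g u < x) \<and> (\<forall>u\<in>{b<..<v}. g u = x) \<and> (\<forall>u\<in>{v<..<c}. g u > x) \<or>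
        (\<forall>u\<in>{a<..<b}. g u > x) \<and> (\<forall>u\<in>{b<..<v}. g u = x) \<and> (\<forall>u\<in>{v<..<c}. g u < x)))}"

text \<open>
  The set \<open>E\<^sub>x\<close> is meant to record every passage of \<open>g\<close> from one side of \<open>x\<close> to the other. Its
  literal definition can miss a passage, and the TVaR formula is then false. Take
  \<open>X\<^sub>1\<close> uniform on the multiset \<open>0, 2, 2, 3, 3\<close> and \<open>X\<^sub>2\<close> uniform on \<open>-4, -3, -2, -1, -1\<close>. On the
  five fifths of \<open>(0, 1)\<close>, \<open>g\<close> equals \<open>-1, 1, 0, 0, -1\<close>, but \<open>g (3/5) = -1\<close>. For \<open>x = 0\<close> this
  one exceptional point keeps \<open>4/5\<close> out of \<open>E\<^sub>x = {1/5}\<close>; at \<open>p = 1/2\<close> the formula would give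
  \<open>0\<close>, whereas the TVaR is \<open>2/5\<close>. A passage can also be missed when \<open>g\<close> touches \<open>x\<close> infinitely often
  just before crossing. The following condition excludes precisely missed passages: between an
  interval where \<open>g\<close> is below \<open>x\<close> and an interval where it is above, there is a point of \<open>E\<^sub>x\<close>.
\<close>

definition crossings_recorded :: "(real \<Rightarrow> real) \<Rightarrow> real \<Rightarrow> bool" where
  "crossings_recorded g x \<longleftrightarrow>
     (\<forall>a b c d. 0 \<le> a \<and> a < b \<and> b \<le> c \<and> c < d \<and> d \<le> 1 \<and>
        ((\<forall>u\<in>{a<..<b}. g u < x) \<and> (\<forall>u\<in>{c<..<d}. g u > x) \<or>
         (\<forall>u\<in>{a<..<b}. g u > x) \<and> (\<forall>u\<in>{c<..<d}. g u < x))
        \<longrightarrow> (\<exists>v\<in>crossing_set g x. b \<le> v \<and> v \<le> c))"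

text \<open>
  \<open>u\<^sub>1 < u\<^sub>2 < \<dots> < u\<^sub>N\<close> lists the elements of \<open>E\<close>. Indices start at 1; for \<open>N = \<infinity>\<close> this is an
  infinite increasing sequence.
\<close>

definition ordered_elements :: "real set \<Rightarrow> enat \<Rightarrow> (nat \<Rightarrow> real) \<Rightarrow> bool" where
  "ordered_elements E N u \<longleftrightarrow>
     strict_mono_on {j. 1 \<le> j \<and> enat j \<le> N} u \<and> u ` {j. 1 \<le> j \<and> enat j \<le> N} = E"


section \<open>The alternating sums\<close>

text \<open>
  The \<open>j\<close>-th summand of a sum from \<open>j = 2\<close> to \<open>N\<close>, padded by zero, so that \<^const>\<open>suminf\<close> is the
  finite sum for finite \<open>N\<close> (zero for \<open>N = 1\<close>) and the limit of partial sums for \<open>N = \<infinity>\<close>.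
  Summability is automatic for finite \<open>N\<close>. For \<open>N = \<infinity>\<close> the sum of \<open>(-1)\<^sup>j (1 - u\<^sub>j)\<close> converges iff
  \<open>u\<^sub>j\<close> tends to 1; otherwise the TVaR formula has no meaning.
\<close>

definition alt_summand :: "enat \<Rightarrow> (nat \<Rightarrow> real) \<Rightarrow> nat \<Rightarrow> real" where
  "alt_summand N f j = (if 2 \<le> j \<and> enat j \<le> N then (-1) ^ j * f j else 0)"

definition T_summand ::
  "'a measure \<Rightarrow> ('a \<Rightarrow> real) \<Rightarrow> ('a \<Rightarrow> real) \<Rightarrow> enat \<Rightarrow> (nat \<Rightarrow> real) \<Rightarrow> nat \<Rightarrow> real" where
  "T_summand M X\<^sub>1 X\<^sub>2 N u =
     alt_summand N (\<lambda>j. (1 - u j) * (TVaR M X\<^sub>1 (u j) + LTVaR M X\<^sub>2 (1 - u j)))"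

definition D_summand :: "enat \<Rightarrow> (nat \<Rightarrow> real) \<Rightarrow> nat \<Rightarrow> real" where
  "D_summand N u = alt_summand N (\<lambda>j. 1 - u j)"

definition t1 ::
  "'a measure \<Rightarrow> ('a \<Rightarrow> real) \<Rightarrow> ('a \<Rightarrow> real) \<Rightarrow> enat \<Rightarrow> (nat \<Rightarrow> real) \<Rightarrow> real \<Rightarrow> real \<Rightarrow> real" where
  "t1 M X\<^sub>1 X\<^sub>2 N u x p =
     (1 - u 1) * (TVaR M X\<^sub>1 (u 1) + LTVaR M X\<^sub>2 (1 - u 1))
     - (\<Sum>j. T_summand M X\<^sub>1 X\<^sub>2 N u j) + x * (u 1 + (\<Sum>j. D_summand N u j) - p)"

definition t2 ::
  "'a measure \<Rightarrow> ('a \<Rightarrow> real) \<Rightarrow> ('a \<Rightarrow> real) \<Rightarrow> enat \<Rightarrow> (nat \<Rightarrow> real) \<Rightarrow> real \<Rightarrow> real \<Rightarrow> real" where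
  "t2 M X\<^sub>1 X\<^sub>2 N u x p =
     u 1 * (LTVaR M X\<^sub>1 (u 1) + TVaR M X\<^sub>2 (1 - u 1))
     + (\<Sum>j. T_summand M X\<^sub>1 X\<^sub>2 N u j) + x * (1 - u 1 - (\<Sum>j. D_summand N u j) - p)"

end

theory Submission
  imports Defs
begin

text \<open>
  For \<open>x\<close> between the left and the right \<open>p\<close>-quantile of \<open>S\<close>,
  \<open>(1 - p) TVaR\<^sub>p[S] = E (S - x)\<^sup>+ + x (1 - p)\<close>, and \<open>E (S - x)\<^sup>+\<close> is the integral of the positive
  part of \<open>h = g - x\<close> over \<open>(0, 1)\<close>. As \<open>g\<close> is continuous off a countable set, the points of \<open>E\<^sub>x\<close> cut
  \<open>(0, 1)\<close> into intervals on which \<open>h\<close> has, almost everywhere, a constant weak sign, and these signs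
  alternate. So the integral of \<open>h\<^sup>+\<close> over \<open>(u\<^sub>1, 1)\<close> is the alternating sum of the tail integrals of
  \<open>h\<close> over the intervals \<open>(u\<^sub>j, 1)\<close> if \<open>h\<close> is positive just after \<open>u\<^sub>1\<close>; the other case follows by
  passing to \<open>-h\<close>. By reflecting the second summand of \<open>g\<close>, the tail integral of \<open>g\<close> over
  \<open>(u\<^sub>j, 1)\<close> is \<open>(1 - u\<^sub>j) (TVaR[X\<^sub>1] + LTVaR[X\<^sub>2])\<close> at levels \<open>u\<^sub>j\<close> and \<open>1 - u\<^sub>j\<close>.
\<close>

section \<open>Quantiles and the excess formula for TVaR\<close>

lemma mono_on_left_quantile:
  assumes "prob_space M" "X \<in> borel_measurable M"
  shows "mono_on {0<..<1} (left_quantile M X)"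
proof -
  interpret cdf_distribution "distr M borel X"
    using assms unfolding cdf_distribution_def by (simp add: prob_space.real_distribution_distr)
  show ?thesis
    using mono_I unfolding left_quantile_def .
qed

text \<open>The Galois connection of cdf and quantile: by right-continuity of the cdf the infimum is
  attained. The comparisons of left and right quantiles below rest on it.\<close>

lemma left_quantile_le_iff:
  assumes "prob_space M" "X \<in> borel_measurable M" "0 < q" "q < 1"
  shows "left_quantile M X q \<le> y \<longleftrightarrow> q \<le> cdf (distr M borel X) y"
proof -
  interpret cdf_distribution "distr M borel X"
    using assms unfolding cdf_distribution_def by (simp add: prob_space.real_distribution_distr)
  show ?thesis
    unfolding left_quantile_def using pseudoinverse[of q y] assms by simp
qed

text \<open>Monotonicity settles only the unit interval. Outside it, the defining set is the whole
  line for \<open>p \<le> 0\<close> and empty for \<open>p > 1\<close>, so the function is constant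
  on each of these pieces, and \<open>p = 1\<close> is a single point.\<close>

lemma borel_measurable_left_quantile:
  assumes "prob_space M" "X \<in> borel_measurable M"
  shows "left_quantile M X \<in> borel_measurable borel"
proof -
  interpret cdf_distribution "distr M borel X"
    using assms unfolding cdf_distribution_def by (simp add: prob_space.real_distribution_distr)
  let ?q = "left_quantile M X"
  \<comment> \<open>\<open>Inf UNIV\<close> and \<open>Inf {}\<close> are unspecified reals, but
    they do not vary with \<open>p\<close>.\<close>
  have out: "?q p = (if p \<le> 0 then Inf UNIV else if p = 1 then ?q 1 else Inf {})"
    if "p \<notin> {0<..<1}" for p
  proof -
    have "{y. p \<le> C y} = UNIV" if "p \<le> 0"
      using that cdf_nonneg order_trans by auto
    moreover have "{y. p \<le> C y} = {}" if "1 < p"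
      using that cdf_bounded_prob by (force simp: not_le intro: le_less_trans)
    ultimately show ?thesis
      using that by (auto simp: left_quantile_def)
  qed
  have out_meas: "(\<lambda>p::real. if p \<le> 0 then Inf UNIV else if p = 1 then ?q 1 else Inf {}) \<in> borel_measurable borel"
    by measurable
  have "?q \<in> borel_measurable (restrict_space borel {0<..<1})"
    by (intro borel_measurable_mono_on_fnc mono_on_left_quantile assms)
  then have "(\<lambda>p. if p \<in> {0<..<1} then ?q p
      else if p \<le> 0 then Inf UNIV else if p = 1 then ?q 1 else Inf {}) \<in> borel_measurable borel"
    using measurable_restrict_space1[OF out_meas]
    by (subst measurable_If_restrict_space_iff) (measurable, simp only: Collect_mem_eq simp_thms)
  also have "(\<lambda>p. if p \<in> {0<..<1} then ?q p
      else if p \<le> 0 then Inf UNIV else if p = 1 then ?q 1 else Inf {}) = ?q"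
    using out by (auto simp: fun_eq_iff)
  finally show ?thesis .
qed

text \<open>Inverse transform sampling: Lebesgue measure on the unit interval plays the role of a
  uniform variable.\<close>

lemma distr_left_quantile:
  assumes "prob_space M" "X \<in> borel_measurable M"
  shows "distr (restrict_space lborel {0<..<1}) borel (left_quantile M X) = distr M borel X"
proof -
  interpret cdf_distribution "distr M borel X"
    using assms unfolding cdf_distribution_def by (simp add: prob_space.real_distribution_distr)
  show ?thesis
    unfolding left_quantile_def by (rule distr_I_eq_M)
qed

lemma
  fixes f :: "real \<Rightarrow> real"
  assumes "prob_space M" "X \<in> borel_measurable M" and f[measurable]: "f \<in> borel_measurable borel"
  shows integrable_left_quantile:
      "integrable M (\<lambda>\<omega>. f (X \<omega>)) \<longleftrightarrow> set_integrable lborel {0<..<1} (\<lambda>q. f (left_quantile M X q))"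
    and integral_left_quantile:
      "(\<integral>\<omega>. f (X \<omega>) \<partial>M) = (LINT q:{0<..<1}|lborel. f (left_quantile M X q))"
proof -
  let ?L = "restrict_space lborel {0<..<1::real}"
  have [measurable]: "left_quantile M X \<in> borel_measurable ?L"
    using borel_measurable_left_quantile[OF assms(1,2)] by (intro measurable_restrict_space1) simp
  note [measurable] = assms(2)
  have "integrable M (\<lambda>\<omega>. f (X \<omega>)) \<longleftrightarrow> integrable (distr M borel X) f"
    by (simp add: integrable_distr_eq)
  also have "\<dots> \<longleftrightarrow> integrable ?L (\<lambda>q. f (left_quantile M X q))"
    unfolding distr_left_quantile[OF assms(1,2), symmetric] by (simp add: integrable_distr_eq)
  finally show "integrable M (\<lambda>\<omega>. f (X \<omega>)) \<longleftrightarrow>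
      set_integrable lborel {0<..<1} (\<lambda>q. f (left_quantile M X q))"
    by (simp add: set_integrable_def integrable_restrict_space)
  have "(\<integral>\<omega>. f (X \<omega>) \<partial>M) = (\<integral>y. f y \<partial>distr M borel X)"
    by (simp add: integral_distr)
  also have "\<dots> = (\<integral>q. f (left_quantile M X q) \<partial>?L)"
    unfolding distr_left_quantile[OF assms(1,2), symmetric] by (simp add: integral_distr)
  finally show "(\<integral>\<omega>. f (X \<omega>) \<partial>M) = (LINT q:{0<..<1}|lborel. f (left_quantile M X q))"
    by (simp add: set_lebesgue_integral_def integral_restrict_space)
qed

section \<open>Left, right and interpolated quantiles\<close>

text \<open>The cdf tends to 1, hence exceeds \<open>p\<close> somewhere. This makes the real-valued
  \<open>Sup\<close> in \<open>right_quantile\<close> a genuine supremum.\<close>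

lemma bdd_above_right_quantile_set:
  assumes "prob_space M" "X \<in> borel_measurable M" "p < 1"
  shows "bdd_above {y. cdf (distr M borel X) y \<le> p}"
proof -
  interpret cdf_distribution "distr M borel X"
    using assms unfolding cdf_distribution_def by (simp add: prob_space.real_distribution_distr)
  obtain y0 where "p < C y0"
    using order_tendstoD(1)[OF cdf_lim_at_top_prob \<open>p < 1\<close>]
    by (auto dest!: eventually_happens'[OF trivial_limit_at_top_linorder])
  then show ?thesis
    using cdf_nondecreasing[of y0] by (intro bdd_aboveI[of _ y0]) (metis leD le_cases le_less_trans mem_Collect_eq)
qed

lemma left_quantile_le_right_quantile:
  assumes "prob_space M" "X \<in> borel_measurable M" "0 < p" "p < 1"
  shows "left_quantile M X p \<le> right_quantile M X p"
proof (rule dense_le)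
  fix z assume "z < left_quantile M X p"
  then have "cdf (distr M borel X) z \<le> p"
    using left_quantile_le_iff[OF assms, of z] by simp
  then show "z \<le> right_quantile M X p"
    unfolding right_quantile_def by (intro cSup_upper bdd_above_right_quantile_set assms) simp
qed

text \<open>A point whose cdf value is at most \<open>p < q\<close> lies strictly below the left
  quantile at \<open>q\<close>. Hence every quantile at a level above \<open>p\<close> bounds the
  interpolated quantiles at \<open>p\<close> from above.\<close>

lemma right_quantile_le_left_quantile:
  assumes "prob_space M" "X \<in> borel_measurable M" "0 < p" "p < q" "q < 1"
  shows "right_quantile M X p \<le> left_quantile M X q"
  unfolding right_quantile_def
proof (rule cSup_least)
  have "left_quantile M X p - 1 \<in> {y. cdf (distr M borel X) y \<le> p}"
    using left_quantile_le_iff[of M X p "left_quantile M X p - 1"] assms by simp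
  then show "{y. cdf (distr M borel X) y \<le> p} \<noteq> {}"
    by blast
  fix y assume "y \<in> {y. cdf (distr M borel X) y \<le> p}"
  then have "\<not> left_quantile M X q \<le> y"
    using left_quantile_le_iff[of M X q y] assms by simp
  then show "y \<le> left_quantile M X q"
    by simp
qed

lemma alpha_quantile_between:
  assumes "prob_space M" "X \<in> borel_measurable M" "0 < p" "p < 1" "0 \<le> \<alpha>" "\<alpha> \<le> 1"
  shows "left_quantile M X p \<le> alpha_quantile M X \<alpha> p"
    "alpha_quantile M X \<alpha> p \<le> right_quantile M X p"
proof -
  let ?l = "left_quantile M X p" and ?r = "right_quantile M X p"
  have "?l \<le> ?r"
    by (intro left_quantile_le_right_quantile assms)
  then have "0 \<le> \<alpha> * (?r - ?l)" "0 \<le> (1 - \<alpha>) * (?r - ?l)"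
    using assms by simp_all
  then show "?l \<le> alpha_quantile M X \<alpha> p" "alpha_quantile M X \<alpha> p \<le> ?r"
    by (simp_all add: alpha_quantile_def algebra_simps)
qed

text \<open>Quantiles at levels up to \<open>p\<close> are at most \<open>x\<close>, those above
  \<open>p\<close> at least \<open>x\<close>. So the positive part of quantile minus
  \<open>x\<close> over the unit interval is just this difference over \<open>{p<..<1}\<close>, and
  adding \<open>x * (1 - p)\<close> restores the tail integral.\<close>

lemma TVaR_eq_excess:
  assumes "prob_space M" "X \<in> borel_measurable M" "0 < p" "p < 1"
    and "left_quantile M X p \<le> x" "x \<le> right_quantile M X p"
    and int: "integrable M (\<lambda>\<omega>. max 0 (X \<omega> - x))"
  shows "TVaR M X p = 1 / (1 - p) * ((\<integral>\<omega>. max 0 (X \<omega> - x) \<partial>M) + x * (1 - p))"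
proof -
  let ?q = "left_quantile M X"
  have [measurable]: "?q \<in> borel_measurable borel"
    by (intro borel_measurable_left_quantile assms)
  have low: "?q q \<le> x" if "0 < q" "q \<le> p" for q
    using mono_onD[OF mono_on_left_quantile[OF assms(1,2)], of q p] that assms by simp
  have high: "x \<le> ?q q" if "p < q" "q < 1" for q
    using right_quantile_le_left_quantile[of M X p q] that assms by simp
  have eq: "indicator {0<..<1} q * max 0 (?q q - x) = indicator {p<..<1} q * (?q q - x)" for q
    using low[of q] high[of q] \<open>0 < p\<close> by (auto simp: indicator_def)
  have "set_integrable lborel {0<..<1} (\<lambda>q. max 0 (?q q - x))"
    using int integrable_left_quantile[of M X "\<lambda>y. max 0 (y - x)"] assms by simp
  then have int1: "set_integrable lborel {p<..<1} (\<lambda>q. ?q q - x)"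
    by (simp add: set_integrable_def eq)
  have int2: "set_integrable lborel {p<..<1} (\<lambda>q. x)"
    using \<open>p < 1\<close> by (simp add: set_integrable_def integrable_indicator_iff emeasure_lborel_Ioo)
  have "(\<integral>\<omega>. max 0 (X \<omega> - x) \<partial>M) = (LINT q:{0<..<1}|lborel. max 0 (?q q - x))"
    using integral_left_quantile[of M X "\<lambda>y. max 0 (y - x)"] assms by simp
  also have "\<dots> = (LINT q:{p<..<1}|lborel. ?q q - x)"
    by (simp add: set_lebesgue_integral_def eq)
  finally have "(\<integral>\<omega>. max 0 (X \<omega> - x) \<partial>M) + x * (1 - p)
      = (LINT q:{p<..<1}|lborel. ?q q - x) + (LINT q:{p<..<1}|lborel. x)"
    using \<open>p < 1\<close> by (simp add: set_lebesgue_integral_def)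
  also have "\<dots> = (LINT q:{p<..<1}|lborel. ?q q)"
    using set_integral_add(2)[OF int1 int2] by simp
  finally show ?thesis
    by (simp add: TVaR_def)
qed

section \<open>Expectations of functions of a uniform variable\<close>

lemma
  fixes f :: "real \<Rightarrow> real"
  assumes U: "U \<in> borel_measurable P" "distr P borel U = uniform_measure lborel {0..1}"
    and f[measurable]: "f \<in> borel_measurable borel"
  shows integrable_uniform: "integrable P (\<lambda>\<omega>. f (U \<omega>)) \<longleftrightarrow> set_integrable lborel {0<..<1} f"
    and integral_uniform: "(\<integral>\<omega>. f (U \<omega>) \<partial>P) = (LINT u:{0<..<1}|lborel. f u)"
proof -
  note [measurable] = U(1)
  have dens: "uniform_measure lborel {0..1::real} = density lborel (\<lambda>x. ennreal (indicator {0..1} x))"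
    by (auto simp: uniform_measure_def indicator_def intro!: density_cong)
  \<comment> \<open>The uniform law sits on the closed interval; its endpoints are null, so values
    of \<open>f\<close> there are irrelevant. For quantiles these values would be arbitrary.\<close>
  have ae: "AE x in lborel. indicator {0..1::real} x *\<^sub>R f x = indicator {0<..<1} x *\<^sub>R f x"
    using AE_lborel_singleton[of 0] AE_lborel_singleton[of 1]
    by eventually_elim (auto simp: indicator_def)
  have "integrable P (\<lambda>\<omega>. f (U \<omega>)) \<longleftrightarrow> integrable (distr P borel U) f"
    by (simp add: integrable_distr_eq)
  also have "\<dots> \<longleftrightarrow> integrable lborel (\<lambda>x. indicator {0..1} x *\<^sub>R f x)"
    unfolding U(2) dens by (subst integrable_density) auto
  also have "\<dots> \<longleftrightarrow> set_integrable lborel {0<..<1} f"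
    unfolding set_integrable_def by (intro integrable_cong_AE ae) auto
  finally show "integrable P (\<lambda>\<omega>. f (U \<omega>)) \<longleftrightarrow> set_integrable lborel {0<..<1} f" .
  have "(\<integral>\<omega>. f (U \<omega>) \<partial>P) = (\<integral>y. f y \<partial>distr P borel U)"
    by (simp add: integral_distr)
  also have "\<dots> = (\<integral>x. indicator {0..1} x *\<^sub>R f x \<partial>lborel)"
    unfolding U(2) dens by (subst integral_density) auto
  also have "\<dots> = (LINT u:{0<..<1}|lborel. f u)"
    unfolding set_lebesgue_integral_def by (intro integral_cong_AE ae) auto
  finally show "(\<integral>\<omega>. f (U \<omega>) \<partial>P) = (LINT u:{0<..<1}|lborel. f u)" .
qed

section \<open>Alternating sums of tail integrals\<close>

lemma set_integral_split:
  fixes h :: "real \<Rightarrow> real"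
  assumes h: "set_integrable lborel {a<..<c} h" and "a \<le> b" "b \<le> c"
  shows "(LINT u:{a<..<c}|lborel. h u) = (LINT u:{a<..<b}|lborel. h u) + (LINT u:{b<..<c}|lborel. h u)"
proof -
  have [measurable]: "(\<lambda>u. indicator {a<..<c} u *\<^sub>R h u) \<in> borel_measurable lborel"
    using h unfolding set_integrable_def by (rule borel_measurable_integrable)
  have int: "set_integrable lborel {a<..<b} h" "set_integrable lborel {b<..<c} h"
    using assms by (auto intro: set_integrable_subset)
  have "(LINT u:{a<..<c}|lborel. h u) = (LINT u:{a<..<b} \<union> {b<..<c}|lborel. h u)"
  proof (rule set_integral_cong_set)
    show "AE u in lborel. u \<in> {a<..<b} \<union> {b<..<c} \<longleftrightarrow> u \<in> {a<..<c}"
      using AE_lborel_singleton[of b] by eventually_elim (use assms in auto)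
  qed (use set_integrable_Un[OF int] h in \<open>auto simp: set_borel_measurable_def set_integrable_def\<close>)
  also have "\<dots> = (LINT u:{a<..<b}|lborel. h u) + (LINT u:{b<..<c}|lborel. h u)"
    using int by (intro set_integral_Un) auto
  finally show ?thesis .
qed

lemma set_integrable_max_0:
  fixes h :: "'a \<Rightarrow> real"
  assumes "set_integrable M A h"
  shows "set_integrable M A (\<lambda>v. max 0 (h v))"
proof -
  have "integrable M (\<lambda>v. max 0 (indicator A v *\<^sub>R h v))"
    using assms by (intro integrable_max) (auto simp: set_integrable_def)
  also have "(\<lambda>v. max 0 (indicator A v *\<^sub>R h v)) = (\<lambda>v. indicator A v *\<^sub>R max 0 (h v))"
    by (auto simp: indicator_def)
  finally show ?thesis
    by (simp add: set_integrable_def)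
qed

text \<open>Dominated convergence with the absolute value of \<open>h\<close> on the unit interval
  as bound: every fixed \<open>u < 1\<close> is eventually passed by \<open>w n\<close>.\<close>

lemma set_integral_tail_tendsto_0:
  fixes h :: "real \<Rightarrow> real"
  assumes h: "set_integrable lborel {0<..<1} h" and w: "w \<longlonglongrightarrow> 1" and w0: "\<And>n. 0 \<le> w n"
  shows "(\<lambda>n. LINT u:{w n<..<1}|lborel. h u) \<longlonglongrightarrow> 0"
proof -
  have hi: "integrable lborel (\<lambda>u. indicator {0<..<1} u *\<^sub>R h u)"
    using h by (simp add: set_integrable_def)
  have "(\<lambda>n. \<integral>u. indicator {w n<..<1} u *\<^sub>R h u \<partial>lborel) \<longlonglongrightarrow> (\<integral>u. 0 \<partial>(lborel :: real measure))"
  proof (rule integral_dominated_convergence[where w = "\<lambda>u. norm (indicator {0<..<1} u *\<^sub>R h u)"])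
    show "AE u in lborel. (\<lambda>n. indicator {w n<..<1} u *\<^sub>R h u) \<longlonglongrightarrow> 0"
    proof (intro always_eventually allI)
      fix u :: real
      have "eventually (\<lambda>n. indicator {w n<..<1} u *\<^sub>R h u = 0) sequentially"
      proof (cases "u < 1")
        case True
        show ?thesis
          using order_tendstoD(1)[OF w True] by eventually_elim auto
      qed simp
      then show "(\<lambda>n. indicator {w n<..<1} u *\<^sub>R h u) \<longlonglongrightarrow> 0"
        by (rule tendsto_eventually)
    qed
    show "(\<lambda>u. indicator {w n<..<1} u *\<^sub>R h u) \<in> borel_measurable lborel" for n
    proof -
      have "set_integrable lborel {w n<..<1} h"
        using w0[of n] by (intro set_integrable_subset[OF h]) auto
      then show ?thesis
        unfolding set_integrable_def by (rule borel_measurable_integrable)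
    qed
    show "AE u in lborel. norm (indicator {w n<..<1} u *\<^sub>R h u) \<le> norm (indicator {0<..<1} u *\<^sub>R h u)" for n
      using w0[of n] by (intro always_eventually) (auto simp: indicator_def)
  qed (use hi in auto)
  then show ?thesis
    by (simp add: set_lebesgue_integral_def)
qed

lemma alternating_tails_sums:
  fixes h :: "real \<Rightarrow> real" and w :: "nat \<Rightarrow> real"
  assumes h: "set_integrable lborel {0<..<1} h"
    and w: "w \<longlonglongrightarrow> 1" and w01: "\<And>j. w j \<in> {0..1}" and incw: "\<And>j. w j \<le> w (Suc j)"
    and sgn: "\<And>j. AE v in lborel. v \<in> {w j<..<w (Suc j)} \<longrightarrow> 0 \<le> (-1) ^ j * h v"
  shows "(\<lambda>j. (-1) ^ j * (LINT v:{w j<..<1}|lborel. h v)) sums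
    (LINT v:{w 0<..<1}|lborel. max 0 (h v))"
proof -
  define H where "H j = (LINT v:{w j<..<1}|lborel. h v)" for j
  define K where "K j = (LINT v:{w j<..<1}|lborel. max 0 (h v))" for j
  note hp = set_integrable_max_0[OF h]
  have step: "(LINT v:{w j<..<1}|lborel. f v) - (LINT v:{w (Suc j)<..<1}|lborel. f v)
      = (LINT v:{w j<..<w (Suc j)}|lborel. f v)"
    if "set_integrable lborel {0<..<1} f" for j and f :: "real \<Rightarrow> real"
  proof -
    have "set_integrable lborel {w j<..<1} f"
      using w01[of j] by (intro set_integrable_subset[OF that]) auto
    then show ?thesis
      using set_integral_split[of "w j" 1 f "w (Suc j)"] w01[of "Suc j"] incw[of j] by simp
  qed
  have meas: "(\<lambda>v. indicator {w j<..<w (Suc j)} v *\<^sub>R f v) \<in> borel_measurable lborel"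
    if "set_integrable lborel {0<..<1} f" for j and f :: "real \<Rightarrow> real"
  proof -
    have "set_integrable lborel {w j<..<w (Suc j)} f"
      using w01[of j] w01[of "Suc j"] by (intro set_integrable_subset[OF that]) auto
    then show ?thesis
      unfolding set_integrable_def by (rule borel_measurable_integrable)
  qed
  have KH: "K j - K (Suc j) = (if even j then H j - H (Suc j) else 0)" for j
  proof (cases "even j")
    case True
    have "(LINT v:{w j<..<w (Suc j)}|lborel. max 0 (h v)) = (LINT v:{w j<..<w (Suc j)}|lborel. h v)"
      unfolding set_lebesgue_integral_def
      using sgn[of j] True
      by (intro integral_cong_AE meas hp h) (auto elim!: eventually_mono simp: indicator_def)
    then show ?thesis
      using True by (simp add: K_def H_def step h hp)
  next
    case False
    have "(LINT v:{w j<..<w (Suc j)}|lborel. max 0 (h v)) = (LINT v:{w j<..<w (Suc j)}|lborel. 0)"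
      unfolding set_lebesgue_integral_def
      using sgn[of j] False
      by (intro integral_cong_AE meas hp) (auto elim!: eventually_mono simp: indicator_def set_integrable_def)
    then show ?thesis
      using False step[OF hp, of j] by (simp add: K_def)
  qed
  \<comment> \<open>The alternating sum pairs the tails into even blocks. After an even last index
    \<open>n\<close> the tail \<open>H n\<close> is still unpaired; it vanishes in the limit, as
    does \<open>K n\<close>.\<close>
  have partial: "(\<Sum>j<Suc n. (-1) ^ j * H j) = K 0 - K n + (if even n then H n else 0)" for n
  proof (induction n)
    case (Suc n)
    then show ?case
      using KH[of n] by (simp split: if_splits)
  qed simp
  have lim: "H \<longlonglongrightarrow> 0" "K \<longlonglongrightarrow> 0"
    unfolding H_def K_def using w01 by (intro set_integral_tail_tendsto_0 h hp w; simp)+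
  have "(\<lambda>n. if even n then H n else 0) \<longlonglongrightarrow> 0"
    by (rule Lim_null_comparison[OF _ tendsto_norm_zero[OF lim(1)]]) auto
  then have "(\<lambda>n. K 0 - K n + (if even n then H n else 0)) \<longlonglongrightarrow> K 0 - 0 + 0"
    by (intro tendsto_intros lim)
  then have "(\<lambda>n. \<Sum>j<Suc n. (-1) ^ j * H j) \<longlonglongrightarrow> K 0"
    unfolding partial by simp
  then have "(\<lambda>n. \<Sum>j<n. (-1) ^ j * H j) \<longlonglongrightarrow> K 0"
    by (rule LIMSEQ_imp_Suc)
  then show ?thesis
    unfolding sums_def by (simp add: H_def K_def)
qed

section \<open>Crossing points\<close>

text \<open>The factor \<open>\<sigma>\<close> folds the two mirror-image alternatives into one, so
  that upward and downward passages are treated together.\<close>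

lemma crossings_recordedD:
  fixes \<sigma> :: real
  assumes "crossings_recorded g x" "\<bar>\<sigma>\<bar> = 1" "0 \<le> a" "a < b" "b \<le> c" "c < d" "d \<le> 1"
    and "\<And>u. u \<in> {a<..<b} \<Longrightarrow> \<sigma> * (g u - x) < 0"
    and "\<And>u. u \<in> {c<..<d} \<Longrightarrow> 0 < \<sigma> * (g u - x)"
  obtains v where "v \<in> crossing_set g x" "b \<le> v" "v \<le> c"
proof -
  have "\<sigma> = 1 \<or> \<sigma> = -1"
    using assms(2) by linarith
  then have "(\<forall>u\<in>{a<..<b}. g u < x) \<and> (\<forall>u\<in>{c<..<d}. g u > x) \<or>
      (\<forall>u\<in>{a<..<b}. g u > x) \<and> (\<forall>u\<in>{c<..<d}. g u < x)"
    using assms(8,9) by auto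
  with assms(3-7) have "\<exists>v\<in>crossing_set g x. b \<le> v \<and> v \<le> c"
    by (intro assms(1)[unfolded crossings_recorded_def, THEN spec, THEN spec, THEN spec, THEN spec, THEN mp, of a b c d]
        conjI)
  then show ?thesis
    using that by blast
qed

text \<open>Here \<open>\<sigma>\<close> is the direction of the passage: 1 for upward, -1 for
  downward.\<close>

lemma crossing_setE:
  assumes "v \<in> crossing_set g x"
  obtains a b c and \<sigma> :: real where "\<bar>\<sigma>\<bar> = 1" "0 \<le> a" "a < b" "b \<le> v" "v < c" "c \<le> 1"
    "\<And>u. u \<in> {a<..<b} \<Longrightarrow> \<sigma> * (g u - x) < 0"
    "\<And>u. u \<in> {b<..<v} \<Longrightarrow> g u = x"
    "\<And>u. u \<in> {v<..<c} \<Longrightarrow> 0 < \<sigma> * (g u - x)"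
proof -
  have "\<exists>a\<in>{0..1}. \<exists>b\<in>{0..1}. \<exists>c\<in>{0..1}. a < b \<and> b \<le> v \<and> v < c \<and>
      ((\<forall>u\<in>{a<..<b}. g u < x) \<and> (\<forall>u\<in>{b<..<v}. g u = x) \<and> (\<forall>u\<in>{v<..<c}. g u > x) \<or>
       (\<forall>u\<in>{a<..<b}. g u > x) \<and> (\<forall>u\<in>{b<..<v}. g u = x) \<and> (\<forall>u\<in>{v<..<c}. g u < x))"
    using assms unfolding crossing_set_def by (simp only: mem_Collect_eq simp_thms)
  then obtain a b c where "a \<in> {0..1}" "c \<in> {0..1}" and abc: "a < b" "b \<le> v" "v < c"
    and *: "(\<forall>u\<in>{a<..<b}. g u < x) \<and> (\<forall>u\<in>{b<..<v}. g u = x) \<and> (\<forall>u\<in>{v<..<c}. g u > x) \<or>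
      (\<forall>u\<in>{a<..<b}. g u > x) \<and> (\<forall>u\<in>{b<..<v}. g u = x) \<and> (\<forall>u\<in>{v<..<c}. g u < x)"
    by (elim bexE conjE) (rule that)
  then have ac: "0 \<le> a" "c \<le> 1"
    by simp_all
  from * show ?thesis
  proof (elim disjE conjE)
    assume "\<forall>u\<in>{a<..<b}. g u < x" "\<forall>u\<in>{b<..<v}. g u = x" "\<forall>u\<in>{v<..<c}. g u > x"
    then show ?thesis
      by (intro that[of 1 a b c] abc ac) simp_all
  next
    assume "\<forall>u\<in>{a<..<b}. g u > x" "\<forall>u\<in>{b<..<v}. g u = x" "\<forall>u\<in>{v<..<c}. g u < x"
    then show ?thesis
      by (intro that[of "-1" a b c] abc ac) simp_all
  qed
qed

section \<open>Signs on the gaps between crossing points\<close>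

text \<open>Isolated exceptional values at jumps may have the wrong sign, so only continuity points
  are tested. The strict witness rules out a vanishing function and makes the sign unique.\<close>

definition essential_sign :: "(real \<Rightarrow> real) \<Rightarrow> real \<Rightarrow> real \<Rightarrow> real \<Rightarrow> real \<Rightarrow> bool" where
  "essential_sign g x s t \<sigma> \<longleftrightarrow> \<bar>\<sigma>\<bar> = 1 \<and>
     (\<forall>z\<in>{s<..<t}. isCont g z \<longrightarrow> 0 \<le> \<sigma> * (g z - x)) \<and>
     (\<exists>z\<in>{s<..<t}. isCont g z \<and> 0 < \<sigma> * (g z - x))"

lemma essential_sign_unique:
  assumes "essential_sign g x s t \<sigma>" "essential_sign g x s t \<tau>"
  shows "\<sigma> = \<tau>"
proof -
  obtain z where "0 \<le> \<sigma> * (g z - x)" "0 < \<tau> * (g z - x)"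
    using assms unfolding essential_sign_def by blast
  moreover have "\<sigma> = 1 \<or> \<sigma> = -1" "\<tau> = 1 \<or> \<tau> = -1"
    using assms unfolding essential_sign_def by linarith+
  ultimately show ?thesis
    by auto
qed

lemma isCont_pos_nhd:
  fixes f :: "real \<Rightarrow> real"
  assumes "isCont f z" "0 < f z" "s < z" "z < t"
  obtains l r where "s \<le> l" "l < z" "z < r" "r \<le> t" "\<And>u. u \<in> {l<..<r} \<Longrightarrow> 0 < f u"
proof -
  have "eventually (\<lambda>u. 0 < f u) (at z)"
    using assms(1,2) by (auto simp: isCont_def intro: order_tendstoD)
  then obtain d where d: "d > 0" "\<And>u. u \<noteq> z \<Longrightarrow> dist u z < d \<Longrightarrow> 0 < f u"
    unfolding eventually_at by auto
  show ?thesis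
  proof (rule that[of "max s (z - d)" "min t (z + d)"])
    fix u assume "u \<in> {max s (z - d)<..<min t (z + d)}"
    then show "0 < f u"
      using d(2)[of u] assms(2) by (cases "u = z") (auto simp: dist_real_def)
  qed (use d(1) assms in auto)
qed

text \<open>If the sign at \<open>y\<close> were strictly opposite to that at \<open>z\<close>,
  continuity would spread both strict signs to open intervals, and \<open>crossings_recorded\<close>
  would place a point of the crossing set between \<open>y\<close> and \<open>z\<close>.\<close>

lemma no_crossing_imp_sign:
  assumes rec: "crossings_recorded g x" and st: "0 \<le> s" "t \<le> 1"
    and E: "crossing_set g x \<inter> {s<..<t} = {}" and \<sigma>: "\<bar>\<sigma>\<bar> = 1"
    and z: "z \<in> {s<..<t}" "isCont g z" "0 < \<sigma> * (g z - x)"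
    and y: "y \<in> {s<..<t}" "isCont g y"
  shows "0 \<le> \<sigma> * (g y - x)"
proof (rule ccontr)
  assume neg: "\<not> 0 \<le> \<sigma> * (g y - x)"
  have cont: "isCont (\<lambda>u. \<tau> * (g u - x)) w" if "isCont g w" for w \<tau>
    using that by (intro continuous_intros)
  obtain lz rz where Z: "s \<le> lz" "lz < z" "z < rz" "rz \<le> t"
      "\<And>u. u \<in> {lz<..<rz} \<Longrightarrow> 0 < \<sigma> * (g u - x)"
    using isCont_pos_nhd[OF cont[OF z(2)] z(3), of s t] z(1) by auto
  have "0 < - \<sigma> * (g y - x)"
    using neg by simp
  then obtain ly ry where Y: "s \<le> ly" "ly < y" "y < ry" "ry \<le> t"
      "\<And>u. u \<in> {ly<..<ry} \<Longrightarrow> 0 < - \<sigma> * (g u - x)"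
    using isCont_pos_nhd[OF cont[OF y(2)], of "- \<sigma>" s t] y(1) by auto
  consider "y < z" | "z < y"
    using neg z(3) by fastforce
  then show False
  proof cases
    case 1
    show False
    \<comment> \<open>Only the outer halves of the two neighbourhoods are used: the crossing point
      then lies in the closed interval from \<open>y\<close> to \<open>z\<close>, hence inside the
      gap.\<close>
    proof (rule crossings_recordedD[OF rec \<sigma>, of ly y z rz])
      show "\<sigma> * (g u - x) < 0" if "u \<in> {ly<..<y}" for u
        using Y(5)[of u] Y(3) that by simp
      show "0 < \<sigma> * (g u - x)" if "u \<in> {z<..<rz}" for u
        using Z(5)[of u] Z(2) that by simp
      show False if "v \<in> crossing_set g x" "y \<le> v" "v \<le> z" for v
        using E y(1) z(1) that by auto
    qed (use 1 Y(1,2) Z(3,4) st in simp_all)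
  next
    case 2
    show False
    proof (rule crossings_recordedD[OF rec, of "- \<sigma>" lz z y ry])
      show "- \<sigma> * (g u - x) < 0" if "u \<in> {lz<..<z}" for u
        using Z(5)[of u] Z(3) that by simp
      show "0 < - \<sigma> * (g u - x)" if "u \<in> {y<..<ry}" for u
        using Y(5)[of u] Y(2) that by simp
      show False if "v \<in> crossing_set g x" "z \<le> v" "v \<le> y" for v
        using E y(1) z(1) that by auto
    qed (use 2 Z(1,2) Y(3,4) st \<sigma> in simp_all)
  qed
qed

lemma exists_isCont_between:
  fixes g :: "real \<Rightarrow> real"
  assumes "countable {v\<in>{0<..<1}. \<not> isCont g v}" "0 \<le> a" "a < b" "b \<le> 1"
  obtains z where "z \<in> {a<..<b}" "isCont g z"
proof -
  have "open {a<..<b}" "{a<..<b} \<noteq> {}"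
    using assms by auto
  then obtain z where "z \<in> {a<..<b}" "z \<notin> {v\<in>{0<..<1}. \<not> isCont g v}"
    using open_minus_countable[OF assms(1)] by metis
  with that assms show ?thesis
    by auto
qed

text \<open>Near \<open>v\<close> the crossing definition supplies opposite strict signs, before the
  flat piece and after \<open>v\<close>. Each extends to its whole gap by
  \<open>no_crossing_imp_sign\<close>, provided that the strict part on the left reaches into the
  left gap.\<close>

lemma crossing_essential_sign:
  assumes rec: "crossings_recorded g x" and ctb: "countable {v\<in>{0<..<1}. \<not> isCont g v}"
    and v: "v \<in> crossing_set g x" and st: "0 \<le> s" "s < v" "v < t" "t \<le> 1"
    and left: "crossing_set g x \<inter> {s<..<v} = {}" and right: "crossing_set g x \<inter> {v<..<t} = {}"
    and s: "s = 0 \<or> s \<in> crossing_set g x"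
  obtains \<sigma> where "essential_sign g x s v (- \<sigma>)" "essential_sign g x v t \<sigma>"
proof -
  obtain a b c \<sigma> where \<sigma>: "\<bar>\<sigma>\<bar> = 1" and abc: "0 \<le> a" "a < b" "b \<le> v" "v < c" "c \<le> 1"
    and neg: "\<And>u. u \<in> {a<..<b} \<Longrightarrow> \<sigma> * (g u - x) < 0"
    and zero: "\<And>u. u \<in> {b<..<v} \<Longrightarrow> g u = x"
    and pos: "\<And>u. u \<in> {v<..<c} \<Longrightarrow> 0 < \<sigma> * (g u - x)"
    by (rule crossing_setE[OF v]) (rule that)
  \<comment> \<open>Otherwise \<open>s\<close> cannot be 0 and is a crossing point, with
    \<open>g\<close> strictly off \<open>x\<close> just to its right; yet the flat piece of
    \<open>v\<close> would cover that place.\<close>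
  have "s < b"
  proof (rule ccontr)
    assume "\<not> s < b"
    with s abc have "b \<le> s" "s \<in> crossing_set g x"
      using st(1) by auto
    obtain c' \<tau> where "s < c'" and pos': "\<And>u. u \<in> {s<..<c'} \<Longrightarrow> 0 < \<tau> * (g u - x)"
      by (rule crossing_setE[OF \<open>s \<in> crossing_set g x\<close>]) (rule that)
    obtain u where "s < u" "u < min v c'"
      using dense[of s "min v c'"] st \<open>s < c'\<close> by auto
    then show False
      using pos'[of u] zero[of u] \<open>b \<le> s\<close> by simp
  qed
  \<comment> \<open>The witness must be a continuity point inside the gap, so the strict interval is
    first cut at \<open>s\<close>; below, the right one is cut at \<open>t\<close>.\<close>
  have "0 \<le> max a s" "max a s < b" "b \<le> 1"
    using \<open>s < b\<close> abc st by auto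
  then obtain y where "y \<in> {max a s<..<b}" and y_cont: "isCont g y"
    by (rule exists_isCont_between[OF ctb])
  then have y: "y \<in> {s<..<v}" "0 < - \<sigma> * (g y - x)"
    using abc neg[of y] by auto
  have "0 \<le> v" "v < min c t" "min c t \<le> 1"
    using abc st by auto
  then obtain z where "z \<in> {v<..<min c t}" and z_cont: "isCont g z"
    by (rule exists_isCont_between[OF ctb])
  then have z: "z \<in> {v<..<t}" "0 < \<sigma> * (g z - x)"
    using pos[of z] by auto
  have "essential_sign g x s v (- \<sigma>)"
    unfolding essential_sign_def
    using no_crossing_imp_sign[OF rec _ _ left _ y(1) y_cont y(2)] y y_cont \<sigma> st abc by auto
  moreover have "essential_sign g x v t \<sigma>"
    unfolding essential_sign_def
    using no_crossing_imp_sign[OF rec _ _ right _ z(1) z_cont z(2)] z z_cont \<sigma> st abc by auto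
  ultimately show ?thesis
    by (rule that)
qed

text \<open>Countable sets are Lebesgue null, so a sign at continuity points suffices for
  integrals.\<close>

lemma essential_sign_AE:
  assumes ctb: "countable {v\<in>{0<..<1}. \<not> isCont g v}" and "0 \<le> s" "t \<le> 1"
    and "essential_sign g x s t \<sigma>"
  shows "AE v in lborel. v \<in> {s<..<t} \<longrightarrow> 0 \<le> \<sigma> * (g v - x)"
proof -
  have "AE v in lborel. v \<notin> {v\<in>{0<..<1}. \<not> isCont g v}"
    by (intro AE_not_in countable_imp_null_set_lborel ctb)
  then show ?thesis
    by eventually_elim (use assms in \<open>auto simp: essential_sign_def\<close>)
qed

text \<open>Indices are shifted to start at 0, and the value 1 stands for the indices beyond \<open>N\<close>.\<close>

definition padded :: "enat \<Rightarrow> (nat \<Rightarrow> real) \<Rightarrow> nat \<Rightarrow> real" where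
  "padded N u n = (if enat (Suc n) \<le> N then u (Suc n) else 1)"

text \<open>Since \<open>F\<close> vanishes at the padding value 1, summands beyond \<open>N\<close>
  need no case distinction. The shift by one flips the sign, and the extra term at
  \<open>n = 0\<close> cancels the first one because the sum starts at \<open>j = 2\<close>.\<close>

lemma alt_summand_Suc:
  assumes "F 1 = 0"
  shows "alt_summand N (\<lambda>j. F (u j)) (Suc n) =
    (if n = 0 then F (padded N u 0) else 0) - (-1) ^ n * F (padded N u n)"
  using assms by (auto simp: alt_summand_def padded_def)

lemma alt_summand_sums_iff:
  assumes "F 1 = 0"
  shows "alt_summand N (\<lambda>j. F (u j)) sums s \<longleftrightarrow>
    (\<lambda>n. (-1) ^ n * F (padded N u n)) sums (F (padded N u 0) - s)"
proof -
  let ?w = "padded N u"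
  have one: "(\<lambda>n. if n = 0 then F (?w 0) else 0) sums F (?w 0)"
    using sums_If_finite[of "\<lambda>n. n = 0" "\<lambda>_. F (?w 0)"] by simp
  have "alt_summand N (\<lambda>j. F (u j)) sums s \<longleftrightarrow> (\<lambda>n. alt_summand N (\<lambda>j. F (u j)) (Suc n)) sums s"
    \<comment> \<open>The summand at index 0, lost by the shift, is zero.\<close>
    by (simp add: sums_Suc_iff) (simp add: alt_summand_def)
  also have "\<dots> \<longleftrightarrow> (\<lambda>n. (if n = 0 then F (?w 0) else 0) - (-1) ^ n * F (?w n)) sums s"
    by (simp only: alt_summand_Suc[where F = F, OF assms])
  also have "\<dots> \<longleftrightarrow> (\<lambda>n. (-1) ^ n * F (?w n)) sums (F (?w 0) - s)"
    using sums_diff[OF one, of "\<lambda>n. (if n = 0 then F (?w 0) else 0) - (-1) ^ n * F (?w n)" s]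
      sums_diff[OF one, of "\<lambda>n. (-1) ^ n * F (?w n)" "F (?w 0) - s"] by auto
  finally show ?thesis .
qed

text \<open>Summands of a convergent series tend to 0, and those of \<open>D_summand\<close> have
  modulus \<open>1 - u j\<close>. For finite \<open>N\<close> the padding itself is eventually
  1.\<close>

lemma padded_tendsto_1:
  assumes "summable (D_summand N u)"
  shows "padded N u \<longlonglongrightarrow> 1"
proof -
  let ?w = "padded N u"
  \<comment> \<open>Nonzero summands start at index 2, which corresponds to position 1 of the padded
    sequence.\<close>
  have "(\<lambda>n. norm (D_summand N u (Suc (Suc n)))) \<longlonglongrightarrow> 0"
    using assms by (intro tendsto_norm_zero LIMSEQ_ignore_initial_segment[where k = 2, simplified] summable_LIMSEQ_zero)
  moreover have "norm (D_summand N u (Suc (Suc n))) = \<bar>1 - ?w (Suc n)\<bar>" for n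
    unfolding D_summand_def using alt_summand_Suc[of "\<lambda>v. 1 - v" N u "Suc n"]
    by (simp add: abs_mult power_abs)
  ultimately have "(\<lambda>n. \<bar>1 - ?w (Suc n)\<bar>) \<longlonglongrightarrow> 0"
    by simp
  then have "(\<lambda>n. 1 - (1 - ?w (Suc n))) \<longlonglongrightarrow> 1 - 0"
    by (intro tendsto_intros) (simp only: tendsto_rabs_zero_iff)
  then show ?thesis
    by (simp add: filterlim_sequentially_Suc)
qed

text \<open>As \<open>E\<close> lies in the open unit interval, \<open>padded N u n < 1\<close>
  holds exactly at the genuine indices. These form an initial segment, so consecutive padded values
  bound gaps free of points of \<open>E\<close>.\<close>

lemma
  assumes u: "ordered_elements E N u" and E: "E \<subseteq> {0<..<1}"
  shows padded_mem: "padded N u n < 1 \<Longrightarrow> padded N u n \<in> E"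
    and padded_range: "padded N u n \<in> {0<..1}"
    and padded_Suc_less: "padded N u n < 1 \<Longrightarrow> padded N u n < padded N u (Suc n)"
    and padded_Suc_le: "padded N u n \<le> padded N u (Suc n)"
    and padded_gap: "E \<inter> {padded N u n<..<padded N u (Suc n)} = {}"
    and padded_gap_0: "E \<inter> {0<..<padded N u 0} = {}"
proof -
  let ?w = "padded N u" and ?J = "{j. 1 \<le> j \<and> enat j \<le> N}"
  have sm: "u i < u j" if "i \<in> ?J" "j \<in> ?J" "i < j" for i j
    using u that strict_mono_onD[of ?J u i j] unfolding ordered_elements_def by simp
  have im: "u ` ?J = E"
    using u by (simp add: ordered_elements_def)
  have wJ: "?w n = u (Suc n) \<and> ?w n \<in> E" if "Suc n \<in> ?J" for n
    using that im by (auto simp: padded_def)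
  have wn: "?w n = 1" if "Suc n \<notin> ?J" for n
    using that by (auto simp: padded_def)
  have down: "i \<in> ?J" if "j \<in> ?J" "1 \<le> i" "i \<le> j" for i j
    using that by (auto intro: order_trans[of "enat i" "enat j"])
  show mem: "?w n < 1 \<Longrightarrow> ?w n \<in> E" for n
    using wJ[of n] wn[of n] by fastforce
  show range: "?w n \<in> {0<..1}" for n
    using wJ[of n] wn[of n] E by (cases "Suc n \<in> ?J") auto
  show less: "?w n < ?w (Suc n)" if "?w n < 1" for n
  proof (cases "Suc (Suc n) \<in> ?J")
    case True
    then have "Suc n \<in> ?J"
      by (rule down) auto
    with True show ?thesis
      using sm[of "Suc n" "Suc (Suc n)"] wJ by simp
  qed (use that wn in simp)
  show "?w n \<le> ?w (Suc n)" for n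
  proof (cases "?w n < 1")
    case False
    then have "Suc n \<notin> ?J"
      using wJ[of n] E by force
    then have "Suc (Suc n) \<notin> ?J"
      using down[of "Suc (Suc n)" "Suc n"] by auto
    then show ?thesis
      using range[of n] wn[of "Suc n"] by simp
  qed (use less[of n] in simp)
  have wu: "?w n \<le> u j" if "j \<in> ?J" "Suc n \<le> j" for n j
    using sm[of "Suc n" j] wJ[of n] down[of j "Suc n"] that by (cases "Suc n = j") auto
  show "E \<inter> {?w n<..<?w (Suc n)} = {}" for n
  proof safe
    fix e assume "e \<in> E" and e: "e \<in> {?w n<..<?w (Suc n)}"
    then obtain j where j: "j \<in> ?J" "e = u j"
      using im by blast
    have "Suc n < j"
    proof (rule ccontr)
      assume "\<not> Suc n < j"
      show False
      proof (cases "Suc n \<in> ?J")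
        case True
        with \<open>\<not> Suc n < j\<close> j e show False
          using sm[of j "Suc n"] wJ[of n] by (cases "j = Suc n") auto
      next
        case False
        with e range[of "Suc n"] show False
          using wn[of n] by auto
      qed
    qed
    then show "e \<in> {}"
      using wu[of j "Suc n"] j e by auto
  qed
  show "E \<inter> {0<..<?w 0} = {}"
    using wu[of _ 0] im by (force simp: image_iff)
qed

section \<open>The TVaR of the counter-monotonic sum\<close>

lemma
  fixes f :: "real \<Rightarrow> real"
  shows set_integrable_reflect: "set_integrable lborel {a<..<b} (\<lambda>u. f (1 - u)) \<longleftrightarrow>
      set_integrable lborel {1 - b<..<1 - a} f"
    and set_integral_reflect: "(LINT u:{a<..<b}|lborel. f (1 - u)) = (LINT u:{1 - b<..<1 - a}|lborel. f u)"
proof -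
  \<comment> \<open>The reflection is written as \<open>1 + (-1) * u\<close> to fit the affine
    substitution rules.\<close>
  have eq: "indicator {a<..<b} u *\<^sub>R f (1 - u) = indicator {1 - b<..<1 - a} (1 + (-1) * u) *\<^sub>R f (1 + (-1) * u)"
    for u :: real
    by (auto simp: indicator_def)
  show "set_integrable lborel {a<..<b} (\<lambda>u. f (1 - u)) \<longleftrightarrow> set_integrable lborel {1 - b<..<1 - a} f"
    unfolding set_integrable_def eq
    by (rule lborel_integrable_real_affine_iff[where f = "\<lambda>v. indicator {1 - b<..<1 - a} v *\<^sub>R f v"]) simp
  show "(LINT u:{a<..<b}|lborel. f (1 - u)) = (LINT u:{1 - b<..<1 - a}|lborel. f u)"
    unfolding set_lebesgue_integral_def eq
    using lborel_integral_real_affine[of "-1" "\<lambda>v. indicator {1 - b<..<1 - a} v *\<^sub>R f v" 1] by simp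
qed

text \<open>The two half-intervals at level 1/2 cover the unit interval up to a null point.\<close>

lemma finite_risk_measures_imp_integrable:
  assumes "finite_risk_measures M X" "prob_space M" "X \<in> borel_measurable M"
  shows "set_integrable lborel {0<..<1} (left_quantile M X)"
proof -
  have [measurable]: "left_quantile M X \<in> borel_measurable borel"
    by (intro borel_measurable_left_quantile assms)
  have "set_integrable lborel ({0<..<1/2} \<union> {1/2<..<1}) (left_quantile M X)"
    using assms(1) unfolding finite_risk_measures_def by (intro set_integrable_Un) auto
  also have "?this \<longleftrightarrow> ?thesis"
    unfolding set_integrable_def using AE_lborel_singleton[of "1/2"]
    by (intro integrable_cong_AE) (auto simp: indicator_def)
  finally show ?thesis .
qed

text \<open>Monotone functions have countably many discontinuities; those of the second summand are
  the reflected ones of the quantile of \<open>X\<^sub>2\<close>.\<close>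

lemma countable_not_isCont_counter_sum:
  assumes "prob_space M" "X\<^sub>1 \<in> borel_measurable M" "X\<^sub>2 \<in> borel_measurable M"
  shows "countable {v\<in>{0<..<1}. \<not> isCont (counter_sum M X\<^sub>1 X\<^sub>2) v}"
proof -
  let ?D = "\<lambda>X. {v\<in>{0<..<1}. \<not> isCont (left_quantile M X) v}"
  have "countable (?D X\<^sub>1)" "countable (?D X\<^sub>2)"
    using mono_on_ctble_discont_open[OF open_greaterThanLessThan mono_on_left_quantile] assms by blast+
  then have "countable (?D X\<^sub>1 \<union> (\<lambda>u. 1 - u) ` ?D X\<^sub>2)"
    by (intro countable_Un countable_image)
  moreover have "{v\<in>{0<..<1}. \<not> isCont (counter_sum M X\<^sub>1 X\<^sub>2) v} \<subseteq> ?D X\<^sub>1 \<union> (\<lambda>u. 1 - u) ` ?D X\<^sub>2"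
  proof
    fix v assume v: "v \<in> {v\<in>{0<..<1}. \<not> isCont (counter_sum M X\<^sub>1 X\<^sub>2) v}"
    show "v \<in> ?D X\<^sub>1 \<union> (\<lambda>u. 1 - u) ` ?D X\<^sub>2"
    proof (rule ccontr)
      assume neg: "v \<notin> ?D X\<^sub>1 \<union> (\<lambda>u. 1 - u) ` ?D X\<^sub>2"
      have "1 - v \<notin> ?D X\<^sub>2"
      proof
        assume "1 - v \<in> ?D X\<^sub>2"
        then have "1 - (1 - v) \<in> (\<lambda>u. 1 - u) ` ?D X\<^sub>2"
          by (rule imageI)
        with neg show False
          by simp
      qed
      then have "isCont (left_quantile M X\<^sub>1) v" "isCont (left_quantile M X\<^sub>2) (1 - v)"
        using neg v by simp_all
      moreover from this(2) have "isCont (\<lambda>u. left_quantile M X\<^sub>2 (1 - u)) v"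
        using isCont_o2[of v "\<lambda>u. 1 - u" "left_quantile M X\<^sub>2"] by simp
      ultimately have "isCont (counter_sum M X\<^sub>1 X\<^sub>2) v"
        unfolding counter_sum_def by (intro continuous_intros)
      with v show False
        by simp
    qed
  qed
  ultimately show ?thesis
    by (rule countable_subset[rotated])
qed

text \<open>The prefactors cancel the normalisations of \<open>TVaR\<close> and
  \<open>LTVaR\<close>, and reflection carries the part of \<open>X\<^sub>2\<close> over
  \<open>{0<..<1 - v}\<close> to \<open>{v<..<1}\<close>, and correspondingly for the lower
  tail.\<close>

lemma
  assumes M: "prob_space M" and X: "X\<^sub>1 \<in> borel_measurable M" "X\<^sub>2 \<in> borel_measurable M"
    and fin: "finite_risk_measures M X\<^sub>1" "finite_risk_measures M X\<^sub>2"
  shows set_integrable_counter_sum: "set_integrable lborel {0<..<1} (counter_sum M X\<^sub>1 X\<^sub>2)"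
    and counter_sum_upper_tail: "0 < v \<Longrightarrow> v < 1 \<Longrightarrow>
      (1 - v) * (TVaR M X\<^sub>1 v + LTVaR M X\<^sub>2 (1 - v)) = (LINT u:{v<..<1}|lborel. counter_sum M X\<^sub>1 X\<^sub>2 u)"
    and counter_sum_lower_tail: "0 < v \<Longrightarrow> v < 1 \<Longrightarrow>
      v * (LTVaR M X\<^sub>1 v + TVaR M X\<^sub>2 (1 - v)) = (LINT u:{0<..<v}|lborel. counter_sum M X\<^sub>1 X\<^sub>2 u)"
proof -
  note int = finite_risk_measures_imp_integrable[OF fin(1) M X(1)]
    finite_risk_measures_imp_integrable[OF fin(2) M X(2)]
  have int2: "set_integrable lborel {0<..<1} (\<lambda>u. left_quantile M X\<^sub>2 (1 - u))"
    using int(2) by (simp add: set_integrable_reflect)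
  show "set_integrable lborel {0<..<1} (counter_sum M X\<^sub>1 X\<^sub>2)"
    unfolding counter_sum_def by (intro set_integral_add int(1) int2)
  have sub: "set_integrable lborel {a<..<b} (left_quantile M X\<^sub>1)"
      "set_integrable lborel {a<..<b} (\<lambda>u. left_quantile M X\<^sub>2 (1 - u))" if "0 \<le> a" "b \<le> 1" for a b
    using that by (auto intro: set_integrable_subset[OF int(1)] set_integrable_subset[OF int2])
  show "(1 - v) * (TVaR M X\<^sub>1 v + LTVaR M X\<^sub>2 (1 - v)) = (LINT u:{v<..<1}|lborel. counter_sum M X\<^sub>1 X\<^sub>2 u)"
    if "0 < v" "v < 1"
    using that sub[of v 1]
    by (simp add: TVaR_def LTVaR_def counter_sum_def set_integral_reflect distrib_left)
  show "v * (LTVaR M X\<^sub>1 v + TVaR M X\<^sub>2 (1 - v)) = (LINT u:{0<..<v}|lborel. counter_sum M X\<^sub>1 X\<^sub>2 u)"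
    if "0 < v" "v < 1"
    using that sub[of 0 v]
    by (simp add: TVaR_def LTVaR_def counter_sum_def set_integral_reflect distrib_left)
qed

theorem theorem5p1:
  fixes M :: "'a measure" and X\<^sub>1 X\<^sub>2 :: "'a \<Rightarrow> real"
    and P :: "'b measure" and U S :: "'b \<Rightarrow> real"
    and g :: "real \<Rightarrow> real" and p \<alpha> x :: real
    and N :: enat and u :: "nat \<Rightarrow> real"
  assumes "prob_space M" "X\<^sub>1 \<in> borel_measurable M" "X\<^sub>2 \<in> borel_measurable M"
    and "finite_risk_measures M X\<^sub>1" "finite_risk_measures M X\<^sub>2"
    and "prob_space P" "U \<in> borel_measurable P"
    and U_uniform: "distr P borel U = uniform_measure lborel {0..1}"
    and g_eq: "g = counter_sum M X\<^sub>1 X\<^sub>2"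
    and S_eq: "S = (\<lambda>\<omega>. g (U \<omega>))"
    and S_nondegenerate: "\<not> (\<exists>c. AE \<omega> in P. S \<omega> = c)"
    and "0 < p" "p < 1" "0 \<le> \<alpha>" "\<alpha> \<le> 1"
    and x_eq: "x = alpha_quantile P S \<alpha> p"
    and "1 \<le> N" and u_enum: "ordered_elements (crossing_set g x) N u"
    and recorded: "crossings_recorded g x"
    and D_converges: "summable (D_summand N u)"
  shows "summable (T_summand M X\<^sub>1 X\<^sub>2 N u) \<and>
    ((\<forall>v\<in>{0<..<u 1}. g v \<le> x) \<longrightarrow> TVaR P S p = 1 / (1 - p) * t1 M X\<^sub>1 X\<^sub>2 N u x p) \<and>
    ((\<forall>v\<in>{0<..<u 1}. g v \<ge> x) \<longrightarrow> TVaR P S p = 1 / (1 - p) * t2 M X\<^sub>1 X\<^sub>2 N u x p)"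
proof -
  let ?E = "crossing_set g x" and ?w = "padded N u"
  define h where "h v = g v - x" for v
  define V where "V = (LINT v:{0<..<1}|lborel. max 0 (h v))"
  have g_meas[measurable]: "g \<in> borel_measurable borel"
  proof -
    have [measurable]: "left_quantile M X\<^sub>1 \<in> borel_measurable borel"
        "left_quantile M X\<^sub>2 \<in> borel_measurable borel"
      using assms by (auto intro: borel_measurable_left_quantile)
    show ?thesis
      unfolding g_eq counter_sum_def by measurable
  qed
  note [measurable] = \<open>U \<in> borel_measurable P\<close>
  have S_meas: "S \<in> borel_measurable P"
    unfolding S_eq by measurable
  have int_const: "set_integrable lborel {a<..<b} (\<lambda>v. c)" for a b c :: real
    by (cases "a \<le> b") (auto simp: set_integrable_def integrable_indicator_iff emeasure_lborel_Ioo)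
  have int_g: "set_integrable lborel {0<..<1} g"
    unfolding g_eq by (intro set_integrable_counter_sum assms)
  then have int_h: "set_integrable lborel {0<..<1} h"
    unfolding h_def by (intro set_integral_diff int_const)
  have int_g': "(LINT v:{a<..<b}|lborel. g v) = (LINT v:{a<..<b}|lborel. h v) + x * (b - a)"
    if "0 \<le> a" "a \<le> b" "b \<le> 1" for a b
  proof -
    have "(LINT v:{a<..<b}|lborel. h v) = (LINT v:{a<..<b}|lborel. g v) - (LINT v:{a<..<b}|lborel. x)"
      unfolding h_def using that by (intro set_integral_diff int_const set_integrable_subset[OF int_g]) auto
    then show ?thesis
      using that by (simp add: set_lebesgue_integral_def)
  qed
  have TVaR_S: "TVaR P S p = 1 / (1 - p) * (V + x * (1 - p))"
  proof -
    have "set_integrable lborel {0<..<1} (\<lambda>v. max 0 (h v))"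
      by (rule set_integrable_max_0[OF int_h])
    then have "integrable P (\<lambda>\<omega>. max 0 (S \<omega> - x))"
      using integrable_uniform[of U P "\<lambda>v. max 0 (h v)"] U_uniform unfolding S_eq h_def by simp
    moreover have "(\<integral>\<omega>. max 0 (S \<omega> - x) \<partial>P) = V"
      using integral_uniform[of U P "\<lambda>v. max 0 (h v)"] U_uniform unfolding S_eq h_def V_def by simp
    \<comment> \<open>The interpolation parameter enters through these two bounds on
      \<open>x\<close>.\<close>
    moreover have "left_quantile P S p \<le> x" "x \<le> right_quantile P S p"
      unfolding x_eq using assms S_meas by (auto intro: alpha_quantile_between)
    ultimately show ?thesis
      using TVaR_eq_excess[of P S p x] S_meas assms by simp
  qed
  have E01: "?E \<subseteq> {0<..<1}"
    by (auto simp: crossing_set_def)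
  note w = padded_mem[OF u_enum E01] padded_range[OF u_enum E01] padded_Suc_less[OF u_enum E01]
    padded_Suc_le[OF u_enum E01] padded_gap[OF u_enum E01] padded_gap_0[OF u_enum E01]
  have w0: "?w 0 = u 1" "0 < u 1" "u 1 < 1"
  proof -
    show "?w 0 = u 1"
      using \<open>1 \<le> N\<close> by (simp add: padded_def one_enat_def)
    have "u 1 \<in> ?E"
      using u_enum \<open>1 \<le> N\<close> unfolding ordered_elements_def by (auto simp: one_enat_def)
    then show "0 < u 1" "u 1 < 1"
      using E01 by auto
  qed
  have ctb: "countable {v\<in>{0<..<1}. \<not> isCont g v}"
    unfolding g_eq by (intro countable_not_isCont_counter_sum assms)
  have w_range: "0 \<le> ?w n" "?w n \<le> 1" for n
    using w(2)[of n] by auto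
  \<comment> \<open>\<open>\<sigma>\<close> is the sign of \<open>h\<close> just after
    \<open>u 1\<close>; the gap before \<open>u 1\<close> starts at 0 and carries the opposite
    sign.\<close>
  obtain \<sigma> where sign_0: "essential_sign g x 0 (?w 0) (- \<sigma>)"
    and sign_1: "essential_sign g x (?w 0) (?w 1) \<sigma>"
  proof -
    have w0_less: "0 < ?w 0" "?w 0 < 1"
      using w0 by simp_all
    show ?thesis
      by (rule crossing_essential_sign[OF recorded ctb w(1)[OF w0_less(2)] order.refl w0_less(1)
            w(3)[OF w0_less(2)] w_range(2) w(6) w(5) disjI1[OF refl]])
        (rule that, simp_all)
  qed
  have \<sigma>: "\<sigma> = 1 \<or> \<sigma> = -1"
    using sign_1 unfolding essential_sign_def by linarith
  have sign: "essential_sign g x (?w n) (?w (Suc n)) ((-1) ^ n * \<sigma>)" if "?w n < 1" for n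
    using that
  proof (induction n)
    case 0
    then show ?case
      using sign_1 by simp
  next
    case (Suc n)
    then have less: "?w n < 1"
      using w(4)[of n] by simp
    obtain \<tau> where \<tau>: "essential_sign g x (?w n) (?w (Suc n)) (- \<tau>)"
        "essential_sign g x (?w (Suc n)) (?w (Suc (Suc n))) \<tau>"
      by (rule crossing_essential_sign[OF recorded ctb w(1)[OF Suc.prems] w_range(1)
            w(3)[OF less] w(3)[OF Suc.prems] w_range(2) w(5) w(5) disjI2[OF w(1)[OF less]]])
    \<comment> \<open>Two consecutive crossing points share a gap, and uniqueness of its sign makes
      the signs alternate.\<close>
    then have "\<tau> = - ((-1) ^ n * \<sigma>)"
      using essential_sign_unique[OF \<tau>(1) Suc.IH[OF less]] by simp
    with \<tau>(2) show ?case
      by simp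
  qed
  \<comment> \<open>The factor \<open>\<sigma>\<close> makes the block right after
    \<open>u 1\<close> nonnegative, as index 0 demands.\<close>
  have "(\<lambda>n. (-1) ^ n * (LINT v:{?w n<..<1}|lborel. \<sigma> * h v)) sums
      (LINT v:{?w 0<..<1}|lborel. max 0 (\<sigma> * h v))"
  proof (rule alternating_tails_sums)
    show "set_integrable lborel {0<..<1} (\<lambda>v. \<sigma> * h v)"
      using int_h by simp
    show "?w \<longlonglongrightarrow> 1"
      by (rule padded_tendsto_1[OF D_converges])
    show "?w j \<in> {0..1}" "?w j \<le> ?w (Suc j)" for j
      using w_range[of j] w(4)[of j] by auto
    show "AE v in lborel. v \<in> {?w j<..<?w (Suc j)} \<longrightarrow> 0 \<le> (-1) ^ j * (\<sigma> * h v)" for j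
    proof (cases "?w j < 1")
      case True
      show ?thesis
        using essential_sign_AE[OF ctb _ _ sign[OF True]] w_range by (simp add: h_def mult.assoc)
    next
      case False
      then show ?thesis
        using w_range[of "Suc j"] by (intro always_eventually) auto
    qed
  qed
  \<comment> \<open>For \<open>\<sigma> = 1\<close> this is the integral of the positive part of
    \<open>h\<close> over \<open>{u 1<..<1}\<close>; for \<open>\<sigma> = -1\<close> it is minus
    that of the negative part.\<close>
  define A where "A = \<sigma> * (LINT v:{?w 0<..<1}|lborel. max 0 (\<sigma> * h v))"
  have "(\<lambda>n. \<sigma> * ((-1) ^ n * (LINT v:{?w n<..<1}|lborel. \<sigma> * h v))) sums A"
    unfolding A_def by (intro sums_mult) fact
  also have "(\<lambda>n. \<sigma> * ((-1) ^ n * (LINT v:{?w n<..<1}|lborel. \<sigma> * h v)))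
      = (\<lambda>n. (-1) ^ n * (LINT v:{?w n<..<1}|lborel. h v))"
    using \<sigma> by (auto simp: fun_eq_iff)
  finally have h_sums: "(\<lambda>n. (-1) ^ n * (LINT v:{?w n<..<1}|lborel. h v)) sums A" .
  define D where "D = (\<Sum>j. D_summand N u j)"
  have "D_summand N u sums D"
    unfolding D_def using D_converges by (rule summable_sums)
  then have D_sums: "(\<lambda>n. (-1) ^ n * (1 - ?w n)) sums (1 - u 1 - D)"
    unfolding D_summand_def using alt_summand_sums_iff[of "\<lambda>v. 1 - v" N u D] w0 by simp
  define G where "G v = (LINT y:{v<..<1}|lborel. g y)" for v
  define H where "H = (LINT v:{u 1<..<1}|lborel. h v)"
  \<comment> \<open>The tail integral vanishes at the padding value, as the reindexing
    requires.\<close>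
  have G1: "G 1 = 0"
    by (simp add: G_def set_lebesgue_integral_def)
  have G_w: "G (?w n) = (LINT v:{?w n<..<1}|lborel. h v) + x * (1 - ?w n)" for n
    unfolding G_def using int_g'[of "?w n" 1] w_range by simp
  have T_eq: "T_summand M X\<^sub>1 X\<^sub>2 N u = alt_summand N (\<lambda>j. G (u j))"
  proof
    fix j
    have "u j \<in> {0<..<1}" if "1 \<le> j" "enat j \<le> N"
      using u_enum that unfolding ordered_elements_def by (intro subsetD[OF E01]) blast
    then show "T_summand M X\<^sub>1 X\<^sub>2 N u j = alt_summand N (\<lambda>j. G (u j)) j"
      using assms by (simp add: T_summand_def alt_summand_def counter_sum_upper_tail G_def)
  qed
  \<comment> \<open>Adding \<open>x\<close> times the series for \<open>D\<close> turns tails of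
    \<open>h\<close> into tails of \<open>g\<close>, which gives both the convergence and the value
    of the \<open>T_summand\<close> series.\<close>
  have "(\<lambda>n. (-1) ^ n * (LINT v:{?w n<..<1}|lborel. h v) + x * ((-1) ^ n * (1 - ?w n)))
      sums (A + x * (1 - u 1 - D))"
    by (intro sums_add sums_mult h_sums D_sums)
  also have "(\<lambda>n. (-1) ^ n * (LINT v:{?w n<..<1}|lborel. h v) + x * ((-1) ^ n * (1 - ?w n)))
      = (\<lambda>n. (-1) ^ n * G (?w n))"
    by (simp add: G_w algebra_simps)
  also have "A + x * (1 - u 1 - D) = G (?w 0) - (H - A + x * D)"
    using G_w[of 0] by (simp add: w0 H_def algebra_simps)
  finally have T_sums: "T_summand M X\<^sub>1 X\<^sub>2 N u sums (H - A + x * D)"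
    unfolding T_eq by (subst alt_summand_sums_iff[of G, OF G1])
  then have T: "(\<Sum>j. T_summand M X\<^sub>1 X\<^sub>2 N u j) = H - A + x * D"
    by (rule sums_unique[symmetric])
  have upper: "(1 - u 1) * (TVaR M X\<^sub>1 (u 1) + LTVaR M X\<^sub>2 (1 - u 1)) = H + x * (1 - u 1)"
    using assms w0 int_g'[of "u 1" 1] by (simp add: counter_sum_upper_tail H_def)
  have lower: "u 1 * (LTVaR M X\<^sub>1 (u 1) + TVaR M X\<^sub>2 (1 - u 1)) = (LINT v:{0<..<u 1}|lborel. h v) + x * u 1"
    using assms w0 int_g'[of 0 "u 1"] by (simp add: counter_sum_lower_tail)
  have V_split: "V = (LINT v:{0<..<u 1}|lborel. max 0 (h v)) + (LINT v:{u 1<..<1}|lborel. max 0 (h v))"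
    unfolding V_def using w0 by (intro set_integral_split set_integrable_max_0 int_h) auto
  \<comment> \<open>A strict value before \<open>u 1\<close> lets each case hypothesis determine
    \<open>\<sigma>\<close>.\<close>
  obtain z where z: "z \<in> {0<..<u 1}" "\<sigma> * (g z - x) < 0"
    using sign_0 w0 unfolding essential_sign_def by auto
  have "TVaR P S p = 1 / (1 - p) * t1 M X\<^sub>1 X\<^sub>2 N u x p" if le: "\<forall>v\<in>{0<..<u 1}. g v \<le> x"
  proof -
    have "\<sigma> = 1"
      using le z \<sigma> by fastforce
    have "(LINT v:{0<..<u 1}|lborel. max 0 (h v)) = (LINT v:{0<..<u 1}|lborel. 0)"
      unfolding set_lebesgue_integral_def using le
      by (intro Bochner_Integration.integral_cong) (auto simp: h_def indicator_def)
    then have "V = A"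
      using V_split \<open>\<sigma> = 1\<close> w0 by (simp add: A_def set_lebesgue_integral_def)
    then show ?thesis
      unfolding TVaR_S t1_def upper T D_def[symmetric] by (simp add: algebra_simps)
  qed
  moreover have "TVaR P S p = 1 / (1 - p) * t2 M X\<^sub>1 X\<^sub>2 N u x p" if ge: "\<forall>v\<in>{0<..<u 1}. g v \<ge> x"
  proof -
    have "\<sigma> = -1"
      using ge z \<sigma> by fastforce
    have "(LINT v:{0<..<u 1}|lborel. max 0 (h v)) = (LINT v:{0<..<u 1}|lborel. h v)"
      unfolding set_lebesgue_integral_def using ge
      by (intro Bochner_Integration.integral_cong) (auto simp: h_def indicator_def)
    \<comment> \<open>Here \<open>- A\<close> integrates the negative part of \<open>h\<close>, and
      adding it to \<open>h\<close> leaves the positive part.\<close>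
    moreover have "H - A = (LINT v:{u 1<..<1}|lborel. max 0 (h v))"
    proof -
      have "set_integrable lborel {0<..<1} (\<lambda>v. - h v)"
        using int_h by (simp add: set_integrable_def)
      then have max_int: "set_integrable lborel {0<..<1} (\<lambda>v. max 0 (- h v))"
        by (rule set_integrable_max_0)
      have sub: "{u 1<..<1} \<subseteq> {0<..<1}"
        using w0 by auto
      have int: "set_integrable lborel {u 1<..<1} h"
          "set_integrable lborel {u 1<..<1} (\<lambda>v. max 0 (- h v))"
        using set_integrable_subset[OF int_h _ sub] set_integrable_subset[OF max_int _ sub] by simp_all
      have "H - A = (LINT v:{u 1<..<1}|lborel. h v) + (LINT v:{u 1<..<1}|lborel. max 0 (- h v))"
        using \<open>\<sigma> = -1\<close> w0 by (simp add: H_def A_def)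
      also have "\<dots> = (LINT v:{u 1<..<1}|lborel. h v + max 0 (- h v))"
        using int by (intro set_integral_add(2)[symmetric])
      also have "(\<lambda>v. h v + max 0 (- h v)) = (\<lambda>v. max 0 (h v))"
        by auto
      finally show ?thesis .
    qed
    ultimately show ?thesis
      using V_split unfolding TVaR_S t2_def lower T D_def[symmetric] by (simp add: algebra_simps)
  qed
  ultimately show ?thesis
    using sums_summable[OF T_sums] by (intro conjI impI)
qed

end
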